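(* Let $a,b,k$ be nonnegative integers with $0\le k\le b$. Under rowmotion on the alt $2$-row-Tamari lattice $\mathsf{T}_{\delta(k)}(a,b)$, the following are independent of the choice of the increment vector $\delta(k)$: (1) the orbit structure; (2) the sum of the down-degree statistic $\mathsf{ddeg}$ over each orbit. More precisely, the multiset of pairs (orbit size, sum of $\mathsf{ddeg}$ over the orbit) does not depend on $k$.
   Context: A lattice path is a finite word in $N$ (unit north step) and $E$ (unit east step), drawn from the origin; exponents denote repetition. For $\nu=E^{\nu_0}NE^{\nu_1}N\cdots NE^{\nu_n}$, a $\nu$-path is a lattice path with the same endpoints as $\nu$ that stays weakly above $\nu$. An increment vector is an integer vector $\delta=(\delta_1,\dots,\delta_n)$ with $0\le\delta_i\le\nu_i$. The $\delta$-altitude along a $\nu$-path is $0$ at the start, decreases by $1$ after each $E$ step, and increases by $\delta_i$ after the $i$th $N$ step. A $\delta$-rotation at a valley $EN$ is defined as follows. Let $x$ be the point between the $E$ and $N$, and let $y$ be the first later point with the same $\delta$-altitude. Interchange the subpath from $x$ to $y$ with the $E$ step preceding $x$. The alt $\nu$-Tamari lattice $\mathrm{Tam}_\delta(\nu)$ is the poset on $\nu$-paths whose cover relations are the $\delta$-rotations. It is a finite semidistributive lattice. The alt $2$-row-Tamari lattice is $\mathsf{T}_{\delta(k)}(a,b)=\mathrm{Tam}_{\delta(k)}(E^aNE^bN)$, where $\delta(k)=(k,0)$ and $0\le k\le b$; these are all the increment vectors of $E^aNE^bN$. Rowmotion on a finite semidistributive lattice is defined as follows. Let $\mathrm{Pop}^{\downarrow}(x)=x\wedge\bigwedge\{y:y\lessdot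 x\}$. Then $\mathrm{Row}(x)$ is the unique maximal element of $\{y: x\wedge y=\mathrm{Pop}^{\downarrow}(x)\}$. The orbit structure is the multiset of orbit sizes. $\mathsf{ddeg}(p)$ is the number of elements covered by $p$. *)

theory Defs
  imports "HOL-Algebra.Lattice" "HOL-Combinatorics.Orbits" "HOL-Library.Multiset"
begin

section \<open>Lattice paths\<close>

datatype step = N | E

type_synonym path = "step list"

text \<open>The lattice point reached from the origin by a word.\<close>

definition endpoint :: "path \<Rightarrow> nat \<times> nat" where
  "endpoint w = (count_list w E, count_list w N)"

text \<open>Every lattice point of \<open>p\<close> lies on, or vertically above, some lattice point of \<open>\<nu>\<close>.\<close>

definition weakly_above :: "path \<Rightarrow> path \<Rightarrow> bool" where
  "weakly_above p \<nu> \<longleftrightarrow>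
     (\<forall>m \<le> length p. \<exists>j \<le> length \<nu>.
        fst (endpoint (take j \<nu>)) = fst (endpoint (take m p)) \<and>
        snd (endpoint (take j \<nu>)) \<le> snd (endpoint (take m p)))"

definition nu_paths :: "path \<Rightarrow> path set" where
  "nu_paths \<nu> = {p. endpoint p = endpoint \<nu> \<and> weakly_above p \<nu>}"

section \<open>Alt \<open>\<nu>\<close>-Tamari lattices\<close>

text \<open>
  The altitude of the point reached by a word. An increment vector is a list, so the increment
  \<open>\<delta>\<^sub>i\<close> (with \<open>i\<close> counted from 1) is \<open>\<delta> ! (i - 1)\<close>.
\<close>

definition altitude :: "nat list \<Rightarrow> path \<Rightarrow> int" where
  "altitude \<delta> w = int (\<Sum>i < count_list w N. \<delta> ! i) - int (count_list w E)"

text \<open>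
  Here \<open>x\<close> is the point reached by \<open>u @ [E]\<close>, and \<open>N # s\<close> is the subpath from \<open>x\<close> to the first
  later point \<open>y\<close> of the same altitude.
\<close>

inductive rotation :: "nat list \<Rightarrow> path \<Rightarrow> path \<Rightarrow> bool" for \<delta> where
  "\<lbrakk>altitude \<delta> (u @ [E] @ N # s) = altitude \<delta> (u @ [E]);
    \<And>j. j < length s \<Longrightarrow> altitude \<delta> (u @ [E] @ N # take j s) \<noteq> altitude \<delta> (u @ [E])\<rbrakk>
   \<Longrightarrow> rotation \<delta> (u @ [E] @ (N # s) @ v) (u @ (N # s) @ [E] @ v)"

definition alt_nu_tamari :: "path \<Rightarrow> nat list \<Rightarrow> path gorder" where
  "alt_nu_tamari \<nu> \<delta> =
     \<lparr>carrier = nu_paths \<nu>, eq = (=),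
      le = (\<lambda>p q. p \<in> nu_paths \<nu> \<and> q \<in> nu_paths \<nu> \<and> rotation \<delta> p q)\<^sup>*\<^sup>*\<rparr>"

definition alt_two_row_tamari :: "nat \<Rightarrow> nat \<Rightarrow> nat \<Rightarrow> path gorder" where
  "alt_two_row_tamari a b k =
     alt_nu_tamari (replicate a E @ [N] @ replicate b E @ [N]) [k, 0]"

section \<open>Rowmotion\<close>

definition lower_covers :: "('a, 'b) gorder_scheme \<Rightarrow> 'a \<Rightarrow> 'a set" where
  "lower_covers L x =
     {y \<in> carrier L. y \<sqsubset>\<^bsub>L\<^esub> x \<and> \<not> (\<exists>z \<in> carrier L. y \<sqsubset>\<^bsub>L\<^esub> z \<and> z \<sqsubset>\<^bsub>L\<^esub> x)}"

definition ddeg :: "('a, 'b) gorder_scheme \<Rightarrow> 'a \<Rightarrow> nat" where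
  "ddeg L x = card (lower_covers L x)"

text \<open>At the bottom element the infimum below is that of the empty set, i.e. the top element.\<close>

definition pop_down :: "('a, 'b) gorder_scheme \<Rightarrow> 'a \<Rightarrow> 'a" where
  "pop_down L x = x \<sqinter>\<^bsub>L\<^esub> \<Sqinter>\<^bsub>L\<^esub>(lower_covers L x)"

definition maximal_elements :: "('a, 'b) gorder_scheme \<Rightarrow> 'a set \<Rightarrow> 'a set" where
  "maximal_elements L S = {y \<in> S. \<not> (\<exists>z \<in> S. y \<sqsubset>\<^bsub>L\<^esub> z)}"

definition row :: "('a, 'b) gorder_scheme \<Rightarrow> 'a \<Rightarrow> 'a" where
  "row L x = (THE y. y \<in> maximal_elements L {y \<in> carrier L. x \<sqinter>\<^bsub>L\<^esub> y = pop_down L x})"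

text \<open>
  Rowmotion permutes the finite carrier, so \<open>orbit (row L) x\<close>, which consists of the iterates with
  positive exponent, is the full orbit of \<open>x\<close>.
\<close>

definition row_orbits :: "('a, 'b) gorder_scheme \<Rightarrow> 'a set set" where
  "row_orbits L = orbit (row L) ` carrier L"

definition orbit_structure :: "('a, 'b) gorder_scheme \<Rightarrow> nat multiset" where
  "orbit_structure L = image_mset card (mset_set (row_orbits L))"

definition orbit_ddeg_structure :: "('a, 'b) gorder_scheme \<Rightarrow> (nat \<times> nat) multiset" where
  "orbit_ddeg_structure L =
     image_mset (\<lambda>S. (card S, \<Sum>p\<in>S. ddeg L p)) (mset_set (row_orbits L))"

end

theory Submission
  imports Defs
begin

text \<open>
  Sort the paths into columns by the position of the first north step. The order, and hence rowmotion,
  is then given by explicit piecewise linear formulas, and rotating every column cyclically by one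
  place conjugates rowmotion for \<open>k\<close> to rowmotion for \<open>k + 1\<close>. The rotation does not preserve the
  down-degree, but it changes it by a coboundary \<open>h x - h (row x)\<close>, which sums to zero over each orbit.
\<close>

section \<open>Weighted orbits\<close>

text \<open>The parameter \<open>k\<close> enters the order at one place: when a rotation moves the
  first north step to the next column, the gap \<open>j\<close> between the two north steps is kept
  if \<open>j < k\<close> and grows by one otherwise. Such a rotation therefore never ends at
  \<open>j = k\<close>, and an element at this level has no lower cover in the preceding column.
  Shifting every \<open>j\<close> by one carries level \<open>k\<close> to level
  \<open>k + 1\<close>, and the shift must wrap around because columns are finite. It is no
  isomorphism of the orders, since the lowest element of a column becomes its top; only rowmotion is
  respected. The down-degree drops at \<open>j = k\<close>, which travels with the shift, and at the
  lowest element of a column, which does not. The correction \<open>h\<close> accounts for the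
  latter.\<close>

definition weighted_orbits :: "('a \<Rightarrow> 'a) \<Rightarrow> ('a \<Rightarrow> nat) \<Rightarrow> 'a set \<Rightarrow> (nat \<times> nat) multiset" where
  "weighted_orbits f w A = image_mset (\<lambda>S. (card S, \<Sum>p\<in>S. w p)) (mset_set (orbit f ` A))"

lemma orbit_subset_of_invariant:
  assumes "f ` A \<subseteq> A" "x \<in> A"
  shows "orbit f x \<subseteq> A"
proof
  fix y assume "y \<in> orbit f x"
  then show "y \<in> A" by induction (use assms in auto)
qed

lemma orbit_semiconj:
  assumes inv: "f ` A \<subseteq> A" and x: "x \<in> A" and conj: "\<And>x. x \<in> A \<Longrightarrow> g (\<psi> x) = \<psi> (f x)"
  shows "orbit g (\<psi> x) = \<psi> ` orbit f x"
proof (intro equalityI subsetI)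
  fix y assume "y \<in> orbit g (\<psi> x)"
  then show "y \<in> \<psi> ` orbit f x"
  proof induction
    case base
    then show ?case using conj[OF x] by (auto intro: orbit.base)
  next
    case (step y)
    then obtain z where "z \<in> orbit f x" "y = \<psi> z" by auto
    then show ?case
      using conj[of z] orbit_subset_of_invariant[OF inv x] by (auto intro: orbit.step)
  qed
next
  fix y assume "y \<in> \<psi> ` orbit f x"
  then obtain z where "z \<in> orbit f x" "y = \<psi> z" by auto
  then show "y \<in> orbit g (\<psi> x)"
  proof (induction arbitrary: y)
    case base
    then show ?case using conj[OF x] orbit.base[of g] by metis
  next
    case (step z)
    then show ?case
      using conj[of z] orbit_subset_of_invariant[OF inv x] orbit.step[of "\<psi> z" g] by auto
  qed
qed

text \<open>\<open>f\<close> permutes each finite orbit, so \<open>h\<close> and its composite with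
  \<open>f\<close> have the same orbit sum and the correction cancels. The condition on
  \<open>h\<close> is additive to stay within \<open>nat\<close>. With \<open>h = 0\<close> it
  serves to pass from paths to coordinates, with a nonzero \<open>h\<close> to compare consecutive
  \<open>k\<close>.\<close>

lemma weighted_orbits_semiconj:
  fixes w h :: "'a \<Rightarrow> nat"
  assumes fin: "finite A" and inv: "f ` A \<subseteq> A" and inj: "inj_on f A" and psi: "inj_on \<psi> A"
    and conj: "\<And>x. x \<in> A \<Longrightarrow> g (\<psi> x) = \<psi> (f x)"
    and cobound: "\<And>x. x \<in> A \<Longrightarrow> w' (\<psi> x) + h (f x) = w x + h x"
  shows "weighted_orbits g w' (\<psi> ` A) = weighted_orbits f w A"
proof -
  have sub: "orbit f x \<subseteq> A" if "x \<in> A" for x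
    using orbit_subset_of_invariant[OF inv that] .
  have orbits: "orbit g ` \<psi> ` A = (`) \<psi> ` orbit f ` A"
    using orbit_semiconj[of f A _ g \<psi>] inv conj by (auto simp: image_iff)
  \<comment> \<open>Distinct orbits have distinct images, so no multiplicities merge in the
    multiset.\<close>
  have inj_image: "inj_on ((`) \<psi>) (orbit f ` A)"
  proof (rule inj_onI)
    fix U V assume "U \<in> orbit f ` A" "V \<in> orbit f ` A" "\<psi> ` U = \<psi> ` V"
    then show "U = V" using inj_on_image_eq_iff[OF psi] sub by (metis imageE)
  qed
  have pair: "(card (\<psi> ` S), \<Sum>p\<in>\<psi> ` S. w' p) = (card S, \<Sum>p\<in>S. w p)"
    if "S \<in> orbit f ` A" for S
  proof -
    obtain x where x: "x \<in> A" "S = orbit f x" using \<open>S \<in> orbit f ` A\<close> by auto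
    have S: "S \<subseteq> A" "finite S" using x sub fin by (auto intro: finite_subset)
    have injS: "inj_on \<psi> S" "inj_on f S" using S psi inj by (auto intro: inj_on_subset)
    have "f ` S = S"
      by (rule endo_inj_surj) (use S injS x in \<open>auto intro: orbit.step\<close>)
    then have "(\<Sum>p\<in>S. h (f p)) = (\<Sum>p\<in>S. h p)"
      using sum.reindex[OF injS(2), of h] by simp
    moreover have "(\<Sum>p\<in>S. w' (\<psi> p) + h (f p)) = (\<Sum>p\<in>S. w p + h p)"
      using cobound S by (intro sum.cong) auto
    ultimately have "(\<Sum>p\<in>S. w' (\<psi> p)) = (\<Sum>p\<in>S. w p)"
      by (simp add: sum.distrib)
    then show ?thesis using injS by (simp add: card_image sum.reindex)
  qed
  have "weighted_orbits g w' (\<psi> ` A) =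
      image_mset (\<lambda>S. (card (\<psi> ` S), \<Sum>p\<in>\<psi> ` S. w' p)) (mset_set (orbit f ` A))"
    unfolding weighted_orbits_def orbits image_mset_mset_set[OF inj_image, symmetric]
    by (simp add: multiset.map_comp o_def)
  also have "\<dots> = weighted_orbits f w A"
    unfolding weighted_orbits_def by (rule image_mset_cong) (use pair fin in auto)
  finally show ?thesis .
qed

section \<open>Rowmotion in a partial order\<close>

context partial_order
begin

text \<open>An infimum is identified by its down-set, which turns lattice computations into
  equivalences about the order. For empty \<open>A\<close> the condition makes \<open>g\<close> the
  top element.\<close>

lemma inf_eqI:
  assumes g: "g \<in> carrier L"
    and glb: "\<And>z. z \<in> carrier L \<Longrightarrow> z \<sqsubseteq> g \<longleftrightarrow> (\<forall>x\<in>A. z \<sqsubseteq> x)"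
    and A: "A \<subseteq> carrier L"
  shows "\<Sqinter>A = g"
proof -
  have "g \<sqsubseteq> x" if "x \<in> A" for x using glb[OF g] g that by simp
  then have "greatest L g (Lower L A)"
    using g glb A by (auto simp: greatest_def Lower_def)
  then show ?thesis
    unfolding inf_def using greatest_unique[of _ "Lower L A"] eq_is_equal
    by (metis (mono_tags, lifting) someI_ex)
qed

text \<open>A cofinal antichain of the strict down-set consists of its maximal elements: anything
  strictly between \<open>y\<close> and \<open>x\<close> would lie under a member of
  \<open>C\<close> that is also above \<open>y\<close>.\<close>

lemma lower_covers_eqI:
  assumes x: "x \<in> carrier L"
    and C: "C \<subseteq> carrier L" "\<And>z. z \<in> C \<Longrightarrow> z \<sqsubset> x"
    and cofinal: "\<And>y. y \<in> carrier L \<Longrightarrow> y \<sqsubset> x \<Longrightarrow> \<exists>z\<in>C. y \<sqsubseteq> z"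
    and antichain: "\<And>y z. y \<in> C \<Longrightarrow> z \<in> C \<Longrightarrow> y \<sqsubseteq> z \<Longrightarrow> y = z"
  shows "lower_covers L x = C"
proof (intro equalityI subsetI)
  fix y assume y: "y \<in> lower_covers L x"
  then obtain z where "z \<in> C" "y \<sqsubseteq> z" "y \<in> carrier L"
    using cofinal by (auto simp: lower_covers_def)
  then show "y \<in> C"
    using y C eq_is_equal by (auto simp: lower_covers_def lless_def)
next
  fix y assume y: "y \<in> C"
  have False if z: "z \<in> carrier L" "y \<sqsubset> z" "z \<sqsubset> x" for z
  proof -
    obtain z' where z': "z' \<in> C" "z \<sqsubseteq> z'" using cofinal z by auto
    then have "y \<sqsubseteq> z'" using z y C by (meson lless_def le_trans subsetD)
    then have "y = z'" using antichain y z' by auto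
    then show False
      using z z' y C eq_is_equal le_antisym[of y z] by (auto simp: lless_def)
  qed
  then show "y \<in> lower_covers L x"
    using y C by (auto simp: lower_covers_def)
qed

text \<open>A greatest solution is the only maximal one, so \<open>THE\<close> picks it.\<close>

lemma row_eqI:
  assumes y: "y \<in> carrier L" "x \<sqinter> y = pop_down L x"
    and max: "\<And>z. z \<in> carrier L \<Longrightarrow> x \<sqinter> z = pop_down L x \<Longrightarrow> z \<sqsubseteq> y"
  shows "row L x = y"
proof -
  have "maximal_elements L {z \<in> carrier L. x \<sqinter> z = pop_down L x} = {y}"
  proof (intro equalityI subsetI)
    fix z assume z: "z \<in> maximal_elements L {z \<in> carrier L. x \<sqinter> z = pop_down L x}"
    then have "z \<sqsubseteq> y" using max by (auto simp: maximal_elements_def)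
    then show "z \<in> {y}" using z y eq_is_equal by (auto simp: maximal_elements_def lless_def)
  next
    fix z assume "z \<in> {y}"
    then show "z \<in> maximal_elements L {z \<in> carrier L. x \<sqinter> z = pop_down L x}"
      using y max eq_is_equal le_antisym by (auto simp: maximal_elements_def lless_def)
  qed
  then show ?thesis unfolding row_def by simp
qed

end

section \<open>Paths with two north steps\<close>

lemma no_N_replicate: "count_list w N = 0 \<Longrightarrow> w = replicate (length w) E"
proof (induction w)
  case (Cons x w)
  then show ?case by (cases x) auto
qed simp

lemma count_list_replicate: "count_list (replicate n x) y = (if x = y then n else 0)"
  by (induction n) auto

lemma first_N_decomp:
  assumes "count_list w N = Suc n"
  obtains i w' where "w = replicate i E @ N # w'" "count_list w' N = n"
proof -
  have "N \<in> set w" using assms by (metis count_list_0_iff nat.distinct(1))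
  then obtain u w' where u: "w = u @ N # w'" "N \<notin> set u" by (meson split_list_first)
  then have "count_list u N = 0" by (simp add: count_list_0_iff)
  then have "w = replicate (length u) E @ N # w'" using u no_N_replicate by metis
  moreover have "count_list w' N = n" using assms u by simp
  ultimately show ?thesis using that by blast
qed

lemma first_N_unique:
  "replicate i E @ N # w = replicate i' E @ N # w' \<longleftrightarrow> i = i' \<and> w = w'"
proof (induction i arbitrary: i')
  case 0
  then show ?case by (cases i') auto
next
  case (Suc i)
  then show ?case by (cases i') auto
qed

lemma two_N_decomp:
  assumes "count_list w N = 2"
  obtains i j l where "w = replicate i E @ N # replicate j E @ N # replicate l E"
  using assms no_N_replicate unfolding numeral_2_eq_2 by (metis first_N_decomp)

text \<open>A valley is located by counting the north steps to its left: none or one.\<close>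

lemma two_N_split:
  assumes "u @ [E] @ N # w = replicate i E @ N # replicate j E @ N # replicate l E"
  obtains (first) "i > 0" "u = replicate (i - 1) E" "w = replicate j E @ N # replicate l E"
    | (second) "j > 0" "u = replicate i E @ N # replicate (j - 1) E" "w = replicate l E"
proof -
  have shift: "replicate p E @ E # v = replicate (Suc p) E @ v" for p v
    by (simp add: replicate_app_Cons_same)
  have "count_list (u @ [E] @ N # w) N = 2"
    unfolding assms by (simp add: count_list_replicate)
  then consider "count_list u N = 0" | "count_list u N = Suc 0"
    by (cases "count_list u N") auto
  then show ?thesis
  proof cases
    case 1
    then obtain p where p: "u = replicate p E" using no_N_replicate by blast
    then have "replicate (Suc p) E @ N # w = replicate i E @ N # replicate j E @ N # replicate l E"
      using assms shift by simp
    then show ?thesis using first p unfolding first_N_unique by auto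
  next
    case 2
    then obtain p q where u: "u = replicate p E @ N # replicate q E"
      using no_N_replicate by (metis first_N_decomp)
    then have "replicate p E @ N # replicate (Suc q) E @ N # w =
        replicate i E @ N # replicate j E @ N # replicate l E"
      using assms shift by simp
    then show ?thesis using second u unfolding first_N_unique by auto
  qed
qed

section \<open>Coordinates on the alt 2-row-Tamari lattice\<close>

text \<open>
  The pair \<open>(c, j)\<close> encodes the path whose first north step has \<open>x\<close>-coordinate \<open>a - c\<close> and whose
  two north steps are separated by \<open>j\<close> east steps.
\<close>

definition coords :: "nat \<Rightarrow> nat \<Rightarrow> (nat \<times> nat) set" where
  "coords a b = {(c, j). c \<le> a \<and> j \<le> b + c}"

fun path_of :: "nat \<Rightarrow> nat \<Rightarrow> nat \<times> nat \<Rightarrow> path" where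
  "path_of a b (c, j) = replicate (a - c) E @ N # replicate j E @ N # replicate (b + c - j) E"

text \<open>Closed form of the order generated by the rotations. Within a column a smaller
  \<open>j\<close> is higher. The \<open>if\<close> is the largest \<open>j\<close> reachable in
  column \<open>c'\<close>, attained by rotating at the first north step only.\<close>

fun below :: "nat \<Rightarrow> nat \<times> nat \<Rightarrow> nat \<times> nat \<Rightarrow> bool" where
  "below k (c, j) (c', j') \<longleftrightarrow> c \<le> c' \<and> j' \<le> (if j < k then j else j + (c' - c))"

lemma finite_coords: "finite (coords a b)"
  by (rule finite_subset[of _ "{..a} \<times> {..b + a}"]) (auto simp: coords_def)

lemma inj_on_path_of: "inj_on (path_of a b) (coords a b)"
  by (rule inj_onI) (auto simp: coords_def first_N_unique)

lemma nu_paths_eq: "nu_paths (replicate a E @ [N] @ replicate b E @ [N]) = path_of a b ` coords a b"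
proof (intro equalityI subsetI)
  let ?\<nu> = "replicate a E @ [N] @ replicate b E @ [N]"
  fix p assume p: "p \<in> nu_paths ?\<nu>"
  then have cnt: "count_list p E = a + b" "count_list p N = 2"
    by (auto simp: nu_paths_def endpoint_def count_list_replicate)
  obtain i j l where ijl: "p = replicate i E @ N # replicate j E @ N # replicate l E"
    using cnt(2) two_N_decomp by blast
  have sum: "i + j + l = a + b" using cnt(1) ijl by (simp add: count_list_replicate)
  \<comment> \<open>The prefix of length \<open>i\<close> ends just before the first north step, at
    height 0. Comparing this single point with the bounding path forces
    \<open>i \<le> a\<close>.\<close>
  have "i \<le> length p" using ijl by simp
  then obtain m where m: "m \<le> length ?\<nu>"
      "fst (endpoint (take m ?\<nu>)) = fst (endpoint (take i p))"
      "snd (endpoint (take m ?\<nu>)) \<le> snd (endpoint (take i p))"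
    using p unfolding nu_paths_def weakly_above_def by blast
  have "take i p = replicate i E" using ijl by simp
  then have "count_list (take m ?\<nu>) E = i" "count_list (take m ?\<nu>) N = 0"
    using m by (auto simp: endpoint_def count_list_replicate)
  moreover from this(2) have "m \<le> a"
    by (cases "m - a") (auto simp: count_list_replicate)
  ultimately have "i \<le> a" by (simp add: count_list_replicate)
  then have "(a - i, j) \<in> coords a b" "p = path_of a b (a - i, j)"
    using sum ijl by (auto simp: coords_def)
  then show "p \<in> path_of a b ` coords a b" by blast
next
  let ?\<nu> = "replicate a E @ [N] @ replicate b E @ [N]"
  fix p assume "p \<in> path_of a b ` coords a b"
  then obtain c j where cj: "c \<le> a" "j \<le> b + c"
      "p = replicate (a - c) E @ N # replicate j E @ N # replicate (b + c - j) E"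
    by (auto simp: coords_def)
  have "weakly_above p ?\<nu>"
    unfolding weakly_above_def
  proof (intro allI impI)
    fix m assume "m \<le> length p"
    define x where "x = count_list (take m p) E"
    have "count_list (take m p) E + count_list (drop m p) E = count_list p E"
      by (metis append_take_drop_id count_list_append)
    then have x_le: "x \<le> a + b" using cj by (simp add: x_def count_list_replicate)
    \<comment> \<open>The witness is the prefix with \<open>x\<close> east steps: of length
      \<open>x\<close> on the first run, and \<open>Suc x\<close> beyond it because one north step
      has been passed. There \<open>p\<close> has passed its first north step too, which sits at
      \<open>a - c \<le> a\<close>.\<close>
    show "\<exists>j\<le>length ?\<nu>. fst (endpoint (take j ?\<nu>)) = fst (endpoint (take m p)) \<and>
        snd (endpoint (take j ?\<nu>)) \<le> snd (endpoint (take m p))"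
    proof (cases "x \<le> a")
      case True
      then show ?thesis
        by (intro exI[of _ x]) (simp add: endpoint_def count_list_replicate x_def[symmetric])
    next
      case False
      have "count_list (take m p) N \<ge> 1"
      proof (cases "m \<le> a - c")
        case True
        then have "x = m" using cj by (simp add: x_def count_list_replicate)
        then show ?thesis using True False by simp
      next
        case False
        then obtain r where "m - (a - c) = Suc r" by (cases "m - (a - c)") auto
        then show ?thesis using cj by simp
      qed
      moreover have "take (Suc x) ?\<nu> = replicate a E @ N # replicate (x - a) E"
        using False x_le by (simp add: Suc_diff_le)
      ultimately show ?thesis using False x_le
        by (intro exI[of _ "Suc x"]) (simp add: endpoint_def count_list_replicate x_def[symmetric])
    qed
  qed
  then show "p \<in> nu_paths ?\<nu>"
    using cj by (simp add: nu_paths_def endpoint_def count_list_replicate)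
qed

section \<open>Rotations in coordinates\<close>

lemma altitude_no_N: "count_list w N = 0 \<Longrightarrow> altitude \<delta> w = - int (count_list w E)"
  by (simp add: altitude_def)

text \<open>The second increment is 0, so one and two north steps contribute the same
  \<open>k\<close>.\<close>

lemma altitude_two_row:
  assumes "count_list w N = 1 \<or> count_list w N = 2"
  shows "altitude [k, 0] w = int k - int (count_list w E)"
proof -
  have "{..<2} = {0, Suc 0}" by auto
  then have "(\<Sum>i<2. [k, 0] ! i) = k" by simp
  then show ?thesis using assms unfolding altitude_def by (auto simp del: of_nat_sum)
qed

text \<open>Used to show that a valley admits only one rotation: \<open>P\<close> will be the return
  of the altitude.\<close>

lemma first_prefix_unique:
  assumes "s @ v = s' @ v'" "P s" "P s'"
    and "\<And>m. m < length s \<Longrightarrow> \<not> P (take m s)" "\<And>m. m < length s' \<Longrightarrow> \<not> P (take m s')"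
  shows "s = s' \<and> v = v'"
proof -
  have "length s = length s'"
  proof (rule linorder_cases[of "length s" "length s'"])
    assume len: "length s < length s'"
    then have "take (length s) s' = s"
      using arg_cong[OF assms(1), of "take (length s)"] by simp
    then show ?thesis using assms(2,5) len by metis
  next
    assume len: "length s' < length s"
    then have "take (length s') s = s'"
      using arg_cong[OF assms(1), of "take (length s')"] by simp
    then show ?thesis using assms(3,4) len by metis
  qed
  then show ?thesis using assms(1) by simp
qed

text \<open>
  With \<open>\<delta> = (k, 0)\<close>, the subpath moved by a rotation at the first valley ends with the \<open>k\<close>-th east
  step after the first north step.
\<close>

lemma rotation_first_valley:
  assumes "c < a" "k \<le> b" "j \<le> b + c"
  defines "w \<equiv> replicate j E @ N # replicate (b + c - j) E"
    and "u \<equiv> replicate (a - c - 1) E"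
  obtains s v where "s @ v = w"
    "altitude [k, 0] (u @ [E] @ N # s) = altitude [k, 0] (u @ [E])"
    "\<And>m. m < length s \<Longrightarrow> altitude [k, 0] (u @ [E] @ N # take m s) \<noteq> altitude [k, 0] (u @ [E])"
    "u @ (N # s) @ [E] @ v = path_of a b (c + 1, if j < k then j else j + 1)"
proof -
  have alt: "altitude [k, 0] (u @ [E] @ N # s) = altitude [k, 0] (u @ [E]) \<longleftrightarrow> count_list s E = k"
    if "count_list s N \<le> 1" for s
  proof -
    have "count_list s N = 0 \<or> count_list s N = 1" using that by auto
    then show ?thesis
      by (auto simp: u_def altitude_no_N altitude_two_row count_list_replicate)
  qed
  have u: "u = replicate (a - (c + 1)) E" by (simp add: u_def)
  \<comment> \<open>If \<open>j < k\<close>, the \<open>k\<close>-th east step lies behind the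
    second north step, so both north steps move and their gap is kept. Otherwise the moved piece
    ends within the gap, and the east step is reinserted there.\<close>
  show ?thesis
  proof (cases "j < k")
    case True
    define s where "s = replicate j E @ N # replicate (k - j) E"
    have "b + c - j = (k - j) + (b + c - k)" "b + (c + 1) - j = (k - j) + Suc (b + c - k)"
      using True assms(2) by auto
    then have 1: "s @ replicate (b + c - k) E = w"
      "u @ (N # s) @ [E] @ replicate (b + c - k) E = path_of a b (c + 1, j)"
      unfolding s_def w_def u path_of.simps by (simp_all only: replicate_add) simp_all
    have 2: "count_list (take m s) E < k" "count_list (take m s) N \<le> 1" if "m < length s" for m
    proof -
      have "m \<le> j \<or> (\<exists>r. m = Suc (j + r) \<and> r < k - j)"
        using that unfolding s_def by (cases "m \<le> j") (auto intro!: exI[of _ "m - Suc j"])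
      then have "count_list (take m s) E < k \<and> count_list (take m s) N \<le> 1"
        using True by (auto simp: s_def count_list_replicate)
      then show "count_list (take m s) E < k" "count_list (take m s) N \<le> 1" by auto
    qed
    have 3: "count_list s E = k" "count_list s N \<le> 1"
      using True by (auto simp: s_def count_list_replicate)
    show ?thesis
      using that[OF 1(1)] 1(2) alt[OF 3(2)] 3(1) alt[OF 2(2)] 2(1) True by force
  next
    case False
    define s where "s = replicate k E"
    define v where "v = replicate (j - k) E @ N # replicate (b + c - j) E"
    have "j = k + (j - k)" "Suc j = k + Suc (j - k)" using False by auto
    then have "replicate j E = s @ replicate (j - k) E"
      "replicate (Suc j) E = s @ [E] @ replicate (j - k) E"
      unfolding s_def by (metis replicate_add, metis replicate_add replicate_Suc append_Cons append_Nil)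
    then have 1: "s @ v = w" "u @ (N # s) @ [E] @ v = path_of a b (c + 1, j + 1)"
      unfolding v_def w_def u path_of.simps by simp_all
    have 2: "count_list (take m s) E < k" "count_list (take m s) N \<le> 1" if "m < length s" for m
      using that by (auto simp: s_def count_list_replicate)
    have 3: "count_list s E = k" "count_list s N \<le> 1"
      by (auto simp: s_def count_list_replicate)
    show ?thesis
      using that[OF 1(1)] 1(2) alt[OF 3(2)] 3(1) alt[OF 2(2)] 2(1) False by force
  qed
qed

text \<open>The disjuncts are the valleys before the second and the first north step. At the former
  the altitude is back immediately, as the increment is 0, so the rotation only swaps the two steps
  of the valley.\<close>

lemma rotation_path_of_iff:
  assumes k: "k \<le> b" and x: "(c, j) \<in> coords a b"
  shows "rotation [k, 0] (path_of a b (c, j)) q \<longleftrightarrow>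
    j > 0 \<and> q = path_of a b (c, j - 1) \<or>
    c < a \<and> q = path_of a b (c + 1, if j < k then j else j + 1)"
proof
  have cj: "c \<le> a" "j \<le> b + c" using x by (auto simp: coords_def)
  assume "rotation [k, 0] (path_of a b (c, j)) q"
  then obtain u s v where rot: "path_of a b (c, j) = u @ [E] @ N # s @ v" "q = u @ (N # s) @ [E] @ v"
      "altitude [k, 0] (u @ [E] @ N # s) = altitude [k, 0] (u @ [E])"
      "\<And>m. m < length s \<Longrightarrow> altitude [k, 0] (u @ [E] @ N # take m s) \<noteq> altitude [k, 0] (u @ [E])"
    by cases auto
  from rot(1)[symmetric, simplified path_of.simps] show
    "j > 0 \<and> q = path_of a b (c, j - 1) \<or>
     c < a \<and> q = path_of a b (c + 1, if j < k then j else j + 1)"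
  proof (cases rule: two_N_split)
    case first
    then have "c < a" by simp
    then obtain s' v' where rot': "s' @ v' = s @ v"
        "altitude [k, 0] (u @ [E] @ N # s') = altitude [k, 0] (u @ [E])"
        "\<And>m. m < length s' \<Longrightarrow> altitude [k, 0] (u @ [E] @ N # take m s') \<noteq> altitude [k, 0] (u @ [E])"
        "u @ (N # s') @ [E] @ v' = path_of a b (c + 1, if j < k then j else j + 1)"
      using rotation_first_valley[of c a k b j] k cj(2) unfolding first(2,3) by metis
    have "s' = s \<and> v' = v"
      by (rule first_prefix_unique[where P = "\<lambda>s. altitude [k, 0] (u @ [E] @ N # s) = altitude [k, 0] (u @ [E])"])
        (use rot rot' in auto)
    then show ?thesis using rot'(4) rot(2) \<open>c < a\<close> by simp
  next
    case second
    have "count_list (s @ v) N = 0" unfolding second(3) by (simp add: count_list_replicate)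
    then have "count_list s N = 0" by simp
    moreover from this have "count_list s E = length s"
      using no_N_replicate[of s] count_list_replicate[of "length s" E E] by simp
    ultimately have "length s = 0"
      using rot(3) unfolding second(2) by (simp add: altitude_two_row count_list_replicate)
    then have "q = u @ N # E # replicate (b + c - j) E" using rot(2) second(3) by simp
    moreover have "b + c - (j - 1) = Suc (b + c - j)" using second(1) cj by simp
    ultimately show ?thesis using second(1,2) by simp
  qed
next
  have cj: "c \<le> a" "j \<le> b + c" using x by (auto simp: coords_def)
  assume "j > 0 \<and> q = path_of a b (c, j - 1) \<or>
    c < a \<and> q = path_of a b (c + 1, if j < k then j else j + 1)"
  then show "rotation [k, 0] (path_of a b (c, j)) q"
  proof (elim disjE conjE)
    assume j: "j > 0" and q: "q = path_of a b (c, j - 1)"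
    define u where "u = replicate (a - c) E @ N # replicate (j - 1) E"
    define v where "v = replicate (b + c - j) E"
    have "b + c - (j - 1) = Suc (b + c - j)" using j cj by simp
    then have q': "q = u @ (N # []) @ [E] @ v" unfolding q u_def v_def by simp
    have "replicate (j - 1) E @ [E] = replicate j E"
      using j by (simp add: replicate_append_same flip: replicate_Suc)
    then have p: "path_of a b (c, j) = u @ [E] @ (N # []) @ v"
      unfolding u_def v_def by simp
    show ?thesis unfolding p q'
      by (rule rotation.intros) (simp_all add: altitude_two_row u_def count_list_replicate)
  next
    assume c: "c < a" and q: "q = path_of a b (c + 1, if j < k then j else j + 1)"
    let ?u = "replicate (a - c - 1) E"
    obtain s v where rot: "s @ v = replicate j E @ N # replicate (b + c - j) E"
      "altitude [k, 0] (?u @ [E] @ N # s) = altitude [k, 0] (?u @ [E])"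
      "\<And>m. m < length s \<Longrightarrow> altitude [k, 0] (?u @ [E] @ N # take m s) \<noteq> altitude [k, 0] (?u @ [E])"
      "?u @ (N # s) @ [E] @ v = path_of a b (c + 1, if j < k then j else j + 1)"
      using rotation_first_valley[OF c k cj(2)] by metis
    have "?u @ [E] = replicate (a - c) E"
      using c by (simp add: replicate_append_same flip: replicate_Suc)
    then have p: "path_of a b (c, j) = ?u @ [E] @ (N # s) @ v" using rot(1) by simp
    show ?thesis unfolding p q rot(4)[symmetric]
      by (rule rotation.intros) (use rot in auto)
  qed
qed

declare path_of.simps [simp del]

section \<open>The order generated by the rotations\<close>

lemma below_refl: "below k x x"
  by (cases x) auto

lemma below_trans: "below k x y \<Longrightarrow> below k y z \<Longrightarrow> below k x z"
  by (cases x; cases y; cases z) (auto split: if_splits)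

lemma below_antisym: "below k x y \<Longrightarrow> below k y x \<Longrightarrow> x = y"
  by (cases x; cases y) (auto split: if_splits)

declare below.simps [simp del]

locale two_row =
  fixes a b k :: nat
  assumes k_le_b: "k \<le> b"
begin

abbreviation "T \<equiv> alt_two_row_tamari a b k"

abbreviation "rot p q \<equiv> p \<in> path_of a b ` coords a b \<and> q \<in> path_of a b ` coords a b \<and> rotation [k, 0] p q"

lemma carrier_T: "carrier T = path_of a b ` coords a b"
  and eq_T: "(.=\<^bsub>T\<^esub>) = (=)"
  and le_T: "(\<sqsubseteq>\<^bsub>T\<^esub>) = rot\<^sup>*\<^sup>*"
  unfolding alt_two_row_tamari_def alt_nu_tamari_def nu_paths_eq by simp_all

lemma rot_imp_below:
  assumes "rot\<^sup>*\<^sup>* (path_of a b x) q" "x \<in> coords a b"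
  shows "\<exists>y\<in>coords a b. q = path_of a b y \<and> below k x y"
  using assms(1)
proof (induction rule: rtranclp_induct)
  case base
  then show ?case using assms(2) below_refl by blast
next
  case (step p q)
  then obtain c j where y: "(c, j) \<in> coords a b" "p = path_of a b (c, j)" "below k x (c, j)"
    by auto
  define y' where "y' = (if j > 0 \<and> q = path_of a b (c, j - 1) then (c, j - 1)
    else (c + 1, if j < k then j else j + 1))"
  have "y' \<in> coords a b" "q = path_of a b y'" "below k (c, j) y'"
    using step(2) y(1) rotation_path_of_iff[OF k_le_b y(1), of q] unfolding y(2) y'_def
    by (auto simp: coords_def below.simps)
  then show ?case using below_trans y(3) by blast
qed

lemma rot_down: "(c, j + n) \<in> coords a b \<Longrightarrow> rot\<^sup>*\<^sup>* (path_of a b (c, j + n)) (path_of a b (c, j))"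
proof (induction n)
  case (Suc n)
  then have in': "(c, j + n) \<in> coords a b" by (auto simp: coords_def)
  then have "rot (path_of a b (c, j + Suc n)) (path_of a b (c, j + n))"
    using Suc.prems rotation_path_of_iff[OF k_le_b Suc.prems] by auto
  then show ?case using Suc.IH[OF in'] by (rule converse_rtranclp_into_rtranclp)
qed simp

lemma rot_right:
  "(c, j) \<in> coords a b \<Longrightarrow> c + n \<le> a \<Longrightarrow>
    rot\<^sup>*\<^sup>* (path_of a b (c, j)) (path_of a b (c + n, if j < k then j else j + n))"
proof (induction n)
  case (Suc n)
  let ?y = "(c + n, if j < k then j else j + n)" and ?z = "(c + Suc n, if j < k then j else j + Suc n)"
  have in': "?y \<in> coords a b" "?z \<in> coords a b"
    using Suc.prems by (auto simp: coords_def)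
  then have "rot (path_of a b ?y) (path_of a b ?z)"
    using Suc.prems rotation_path_of_iff[OF k_le_b in'(1)] by auto
  then show ?case using Suc by (auto intro: rtranclp.rtrancl_into_rtrancl)
qed simp

text \<open>For the converse, rotating first across the columns and then down in \<open>j\<close>
  reaches every permitted target, since crossing never switches between \<open>j < k\<close> and
  \<open>j \<ge> k\<close>.\<close>

lemma le_path_of_iff:
  assumes x: "x \<in> coords a b" and y: "y \<in> coords a b"
  shows "path_of a b x \<sqsubseteq>\<^bsub>T\<^esub> path_of a b y \<longleftrightarrow> below k x y"
proof
  assume "path_of a b x \<sqsubseteq>\<^bsub>T\<^esub> path_of a b y"
  then obtain z where z: "z \<in> coords a b" "path_of a b y = path_of a b z" "below k x z"
    using rot_imp_below[of x] x unfolding le_T by blast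
  then show "below k x y"
    using inj_onD[OF inj_on_path_of z(2) y z(1)] by simp
next
  assume xy: "below k x y"
  obtain c j c' j' where cj: "x = (c, j)" "y = (c', j')" by (cases x; cases y) auto
  obtain n where n: "c' = c + n" using xy cj by (auto simp: below.simps le_iff_add)
  let ?m = "if j < k then j else j + n"
  obtain d where d: "?m = j' + d" using xy cj n by (auto simp: below.simps le_iff_add split: if_splits)
  have in': "(c', j' + d) \<in> coords a b"
    using x y unfolding d[symmetric] cj n by (auto simp: coords_def)
  have "rot\<^sup>*\<^sup>* (path_of a b x) (path_of a b (c', j' + d))"
    using rot_right[of c j n] x y unfolding d[symmetric] cj n by (auto simp: coords_def)
  then show "path_of a b x \<sqsubseteq>\<^bsub>T\<^esub> path_of a b y"
    using rot_down[OF in'] unfolding le_T cj by (rule rtranclp_trans)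
qed

sublocale partial_order T
proof
  show "(.=\<^bsub>T\<^esub>) = (=)" by (rule eq_T)
qed (auto simp: eq_T carrier_T le_path_of_iff intro: below_refl below_trans dest: below_antisym)

lemma lless_path_of_iff:
  "x \<in> coords a b \<Longrightarrow> y \<in> coords a b \<Longrightarrow> path_of a b x \<sqsubset>\<^bsub>T\<^esub> path_of a b y \<longleftrightarrow> below k x y \<and> x \<noteq> y"
  using inj_on_path_of[of a b] by (auto simp: lless_def eq_T le_path_of_iff inj_on_def)

end

section \<open>Rowmotion in coordinates\<close>

text \<open>The meet lies in the earlier column. The point of the later column is projected to the
  highest element of the earlier one below it: \<open>j\<close> shrinks by the column distance, but
  not past \<open>k\<close>. Then \<open>max\<close> takes the lower of two elements of one
  column.\<close>

fun meet_coord :: "nat \<Rightarrow> nat \<times> nat \<Rightarrow> nat \<times> nat \<Rightarrow> nat \<times> nat" where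
  "meet_coord k (c, j) (c', j') =
     (if c \<le> c' then (c, max j (if j' \<le> k then j' else max k (j' - (c' - c))))
      else (c', max j' (if j \<le> k then j else max k (j - (c - c')))))"

text \<open>The rotations ending at \<open>(c, j)\<close>, read backwards.\<close>

fun covers_coord :: "nat \<Rightarrow> nat \<Rightarrow> nat \<times> nat \<Rightarrow> (nat \<times> nat) set" where
  "covers_coord b k (c, j) = (if j < b + c then {(c, j + 1)} else {}) \<union>
     (if c > 0 \<and> j \<noteq> k then {(c - 1, if j < k then j else j - 1)} else {})"

fun pop_coord :: "nat \<Rightarrow> nat \<Rightarrow> nat \<times> nat \<Rightarrow> nat \<times> nat" where
  "pop_coord b k (c, j) =
     (if j = b + c then (if c = 0 then (c, j) else (c - 1, j - 1))
      else if j = k \<or> c = 0 then (c, j + 1)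
      else (c - 1, if j < k then j + 1 else j))"

text \<open>Solved from the meet equation. With two lower covers the only solution is the pop-down
  itself. If \<open>(c, j + 1)\<close> is the only cover, the solutions lie in columns from
  \<open>c\<close> on, and the greatest is the highest element of column \<open>a\<close> that
  projects to \<open>(c, j + 1)\<close>. For the lowest element of a column \<open>c > 0\<close>,
  all of column \<open>c - 1\<close> solves it, so the top of that column is taken.\<close>

fun row_coord :: "nat \<Rightarrow> nat \<Rightarrow> nat \<Rightarrow> nat \<times> nat \<Rightarrow> nat \<times> nat" where
  "row_coord a b k (c, j) =
     (if j = b + c then (if c = 0 then (a, 0) else (c - 1, 0))
      else if j = k \<or> c = 0 then (a, if j < k then j + 1 else j + 1 + (a - c))
      else (c - 1, if j < k then j + 1 else j))"

fun ddeg_coord :: "nat \<Rightarrow> nat \<Rightarrow> nat \<times> nat \<Rightarrow> nat" where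
  "ddeg_coord b k (c, j) = (if j < b + c then 1 else 0) + (if c > 0 \<and> j \<noteq> k then 1 else 0)"

context two_row
begin

section \<open>Meets\<close>

lemma meet_coord_in: "x \<in> coords a b \<Longrightarrow> y \<in> coords a b \<Longrightarrow> meet_coord k x y \<in> coords a b"
  using k_le_b by (cases x; cases y) (auto simp: coords_def)

lemma below_meet_coord_iff: "below k z (meet_coord k x y) \<longleftrightarrow> below k z x \<and> below k z y"
proof -
  \<comment> \<open>Projecting loses nothing: an element of column \<open>c0\<close> is below a
    point of column \<open>c'\<close> iff it is below the projection to the intermediate column
    \<open>c\<close>.\<close>
  have low: "(if j' \<le> k then j' else max k (j' - (c' - c))) \<le> (if j0 < k then j0 else j0 + (c - c0)) \<longleftrightarrow>
      j' \<le> (if j0 < k then j0 else j0 + (c' - c0))" if "c0 \<le> c" "c \<le> c'" for c0 j0 c c' j'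
    using that by auto
  obtain c j c' j' c0 j0 where xyz: "x = (c, j)" "y = (c', j')" "z = (c0, j0)"
    by (cases x; cases y; cases z)
  show ?thesis
  proof (cases "c \<le> c'")
    case True
    then show ?thesis
      using low[of c0 c c' j' j0] unfolding xyz meet_coord.simps by (auto simp: below.simps simp del: if_split)
  next
    case False
    then show ?thesis
      using low[of c0 c' c j j0] unfolding xyz meet_coord.simps by (auto simp: below.simps simp del: if_split)
  qed
qed

lemma meet_path_of:
  assumes "x \<in> coords a b" "y \<in> coords a b"
  shows "path_of a b x \<sqinter>\<^bsub>T\<^esub> path_of a b y = path_of a b (meet_coord k x y)"
  unfolding meet_def
  by (rule inf_eqI)
    (use assms meet_coord_in[OF assms] in \<open>auto simp: eq_T carrier_T le_path_of_iff below_meet_coord_iff\<close>)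

section \<open>Lower covers\<close>

lemma covers_coord_in: "x \<in> coords a b \<Longrightarrow> covers_coord b k x \<subseteq> coords a b"
  using k_le_b by (cases x) (auto simp: coords_def)

lemma covers_coord_below: "z \<in> covers_coord b k x \<Longrightarrow> below k z x \<and> z \<noteq> x"
  by (cases x) (auto simp: below.simps split: if_splits)

text \<open>An element of an earlier column lies below the cover in column \<open>c - 1\<close> if
  there is one. At \<open>j = k\<close> there is none, but then \<open>j' \<ge> k\<close>, so
  \<open>y\<close> still reaches level \<open>k + 1\<close> in column \<open>c\<close>.\<close>

lemma covers_coord_cofinal:
  assumes "y \<in> coords a b" "x \<in> coords a b" "below k y x" "y \<noteq> x"
  shows "\<exists>z\<in>covers_coord b k x. below k y z"
proof -
  obtain c j c' j' where xy: "x = (c, j)" "y = (c', j')"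
    by (cases x; cases y)
  have le: "c' \<le> c" "j \<le> (if j' < k then j' else j' + (c - c'))" "j' \<le> b + c'" "j \<le> b + c"
    using assms by (auto simp: xy below.simps coords_def)
  consider (vertical) "c' = c" "j < j'" | (corner) "c' < c" "j = k" | (low) "c' < c" "j < k"
    | (high) "c' < c" "k < j"
  proof (cases "c' = c")
    case True
    then show ?thesis using le(2) assms(4) xy vertical by (auto split: if_splits)
  next
    case False
    then have "c' < c" using le(1) by simp
    then show ?thesis using corner low high by (cases rule: linorder_cases[of j k]) auto
  qed
  then show ?thesis
  proof cases
    case vertical
    then show ?thesis using le by (auto simp: xy below.simps)
  next
    case corner
    then have "k \<le> j'" "k < b + c" using le(2) k_le_b by (auto split: if_splits)
    then show ?thesis using corner by (auto simp: xy below.simps)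
  next
    case low
    then show ?thesis using le(2) by (auto simp: xy below.simps split: if_splits)
  next
    case high
    then have "k \<le> j'" using le(2) by (auto split: if_splits)
    then show ?thesis using high le(2) by (auto simp: xy below.simps)
  qed
qed

lemma covers_coord_antichain:
  "y \<in> covers_coord b k x \<Longrightarrow> z \<in> covers_coord b k x \<Longrightarrow> below k y z \<Longrightarrow> y = z"
  by (cases x) (auto simp: below.simps split: if_splits)

lemma lower_covers_path_of:
  assumes x: "x \<in> coords a b"
  shows "lower_covers T (path_of a b x) = path_of a b ` covers_coord b k x"
proof (rule lower_covers_eqI)
  have C: "z \<in> coords a b" if "z \<in> covers_coord b k x" for z
    using covers_coord_in[OF x] that by blast
  show "path_of a b ` covers_coord b k x \<subseteq> carrier T"
    using C by (auto simp: carrier_T simp del: covers_coord.simps)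
  show "path_of a b x \<in> carrier T" using x by (simp add: carrier_T)
  show "z \<sqsubset>\<^bsub>T\<^esub> path_of a b x" if "z \<in> path_of a b ` covers_coord b k x" for z
    using that C covers_coord_below x lless_path_of_iff by blast
  show "\<exists>z\<in>path_of a b ` covers_coord b k x. y \<sqsubseteq>\<^bsub>T\<^esub> z"
    if y: "y \<in> carrier T" "y \<sqsubset>\<^bsub>T\<^esub> path_of a b x" for y
  proof -
    obtain y' where y': "y' \<in> coords a b" "y = path_of a b y'"
      using y(1) by (auto simp: carrier_T)
    then have "below k y' x" "y' \<noteq> x" using y(2) x lless_path_of_iff by blast+
    then obtain z where z: "z \<in> covers_coord b k x" "below k y' z"
      using covers_coord_cofinal y' x by blast
    then show ?thesis using y' C le_path_of_iff by blast
  qed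
  show "y = z" if "y \<in> path_of a b ` covers_coord b k x" "z \<in> path_of a b ` covers_coord b k x"
    "y \<sqsubseteq>\<^bsub>T\<^esub> z" for y z
    using that C covers_coord_antichain le_path_of_iff by blast
qed

lemma ddeg_path_of:
  assumes x: "x \<in> coords a b"
  shows "ddeg T (path_of a b x) = ddeg_coord b k x"
proof -
  have "inj_on (path_of a b) (covers_coord b k x)"
    using inj_on_path_of covers_coord_in[OF x] by (rule inj_on_subset)
  then have "ddeg T (path_of a b x) = card (covers_coord b k x)"
    unfolding ddeg_def lower_covers_path_of[OF x] by (rule card_image)
  also have "\<dots> = ddeg_coord b k x"
    by (cases x) auto
  finally show ?thesis .
qed

section \<open>The pop-down operator\<close>

lemma pop_coord_in: "x \<in> coords a b \<Longrightarrow> pop_coord b k x \<in> coords a b"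
  using k_le_b by (cases x) (auto simp: coords_def)

text \<open>Listing \<open>x\<close> next to its covers makes the equivalence hold at the bottom
  element as well.\<close>

lemma below_pop_coord_iff:
  assumes "x \<in> coords a b" "z \<in> coords a b"
  shows "below k z (pop_coord b k x) \<longleftrightarrow> below k z x \<and> (\<forall>y\<in>covers_coord b k x. below k z y)"
proof -
  obtain c j c' j' where xz: "x = (c, j)" "z = (c', j')"
    by (cases x; cases z)
  have le: "j' \<le> b + c'" "j \<le> b + c"
    using assms by (auto simp: xz coords_def)
  consider "j = b + c" "c = 0" | "j = b + c" "c > 0" "k < j" | "j < b + c" "j = k \<or> c = 0"
    | "j < b + c" "c > 0" "j < k" | "j < b + c" "c > 0" "k < j"
    using le(2) k_le_b by linarith
  then show ?thesis
    by cases (use le in \<open>auto simp: xz below.simps\<close>)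
qed

lemma pop_down_path_of:
  assumes x: "x \<in> coords a b"
  shows "pop_down T (path_of a b x) = path_of a b (pop_coord b k x)"
proof -
  define I where "I = \<Sqinter>\<^bsub>T\<^esub>(lower_covers T (path_of a b x))"
  have C: "y \<in> coords a b" if "y \<in> covers_coord b k x" for y
    using covers_coord_in[OF x] that by blast
  obtain i where i: "i \<in> coords a b" "I = path_of a b i"
    and i_iff: "\<And>z. z \<in> coords a b \<Longrightarrow> below k z i \<longleftrightarrow> (\<forall>y\<in>covers_coord b k x. below k z y)"
  proof (cases "covers_coord b k x = {}")
    \<comment> \<open>Only the bottom \<open>(0, b)\<close> has no covers. The empty infimum is the
      top \<open>(a, 0)\<close>, and the meet with it gives back the bottom.\<close>
    case True
    have top: "(a, 0) \<in> coords a b" "\<And>z. z \<in> coords a b \<Longrightarrow> below k z (a, 0)"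
      by (auto simp: coords_def below.simps)
    have "I = path_of a b (a, 0)"
      unfolding I_def lower_covers_path_of[OF x] True
      by (rule inf_eqI) (use top in \<open>auto simp: carrier_T le_path_of_iff\<close>)
    then show ?thesis using that[of "(a, 0)"] top True by simp
  next
    case False
    \<comment> \<open>Some cover exists and lies below \<open>x\<close>, so the condition on
      \<open>x\<close> is implied.\<close>
    have below_iff: "below k z (pop_coord b k x) \<longleftrightarrow> (\<forall>y\<in>covers_coord b k x. below k z y)"
      if "z \<in> coords a b" for z
      using below_pop_coord_iff[OF x that] False covers_coord_below below_trans by blast
    have "I = path_of a b (pop_coord b k x)"
      unfolding I_def lower_covers_path_of[OF x]
    proof (rule inf_eqI)
      fix z assume "z \<in> carrier T"
      then obtain z' where z': "z' \<in> coords a b" "z = path_of a b z'" by (auto simp: carrier_T)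
      show "z \<sqsubseteq>\<^bsub>T\<^esub> path_of a b (pop_coord b k x) \<longleftrightarrow>
          (\<forall>y\<in>path_of a b ` covers_coord b k x. z \<sqsubseteq>\<^bsub>T\<^esub> y)"
        unfolding z'(2) using below_iff[OF z'(1)]
        by (simp add: le_path_of_iff z'(1) C pop_coord_in[OF x])
    qed (use C pop_coord_in[OF x] in \<open>auto simp: carrier_T simp del: covers_coord.simps\<close>)
    then show ?thesis using that[OF pop_coord_in[OF x]] below_iff by simp
  qed
  have "below k z (meet_coord k x i) \<longleftrightarrow> below k z (pop_coord b k x)" if "z \<in> coords a b" for z
    using below_pop_coord_iff[OF x that] i_iff[OF that] below_meet_coord_iff by simp
  then have "meet_coord k x i = pop_coord b k x"
    using below_antisym below_refl meet_coord_in[OF x i(1)] pop_coord_in[OF x] by metis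
  then show ?thesis
    using meet_path_of[OF x i(1)] i(2) unfolding pop_down_def I_def by simp
qed

section \<open>Rowmotion\<close>

lemma row_coord_in: "x \<in> coords a b \<Longrightarrow> row_coord a b k x \<in> coords a b"
  using k_le_b by (cases x) (auto simp: coords_def)

lemma meet_row_coord:
  assumes "x \<in> coords a b"
  shows "meet_coord k x (row_coord a b k x) = pop_coord b k x"
proof -
  obtain c j where x: "x = (c, j)" by (cases x)
  have le: "c \<le> a" "j \<le> b + c" using assms by (auto simp: x coords_def)
  consider "j = b + c" "c = 0" | "j = b + c" "c > 0" "k < j" | "j < b + c" "j = k \<or> c = 0" "k \<le> j"
    | "j < b + c" "j = k \<or> c = 0" "j < k"
    | "j < b + c" "c > 0" "j < k" | "j < b + c" "c > 0" "k < j"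
    using le(2) k_le_b by linarith
  then show ?thesis
    by cases (use le in \<open>auto simp: x\<close>)
qed

lemma row_coord_greatest:
  assumes "x \<in> coords a b" "y \<in> coords a b" "meet_coord k x y = pop_coord b k x"
  shows "below k y (row_coord a b k x)"
proof -
  obtain c j c' j' where xy: "x = (c, j)" "y = (c', j')" by (cases x; cases y)
  have le: "c \<le> a" "j \<le> b + c" "c' \<le> a" "j' \<le> b + c'" using assms by (auto simp: xy coords_def)
  note meet = assms(3)[unfolded xy]
  consider "j = b + c" "c = 0" | "j = b + c" "c > 0" "k < j" | "j < b + c" "j = k \<or> c = 0" "k \<le> j"
    | "j < b + c" "j = k \<or> c = 0" "j < k"
    | "j < b + c" "c > 0" "j < k" | "j < b + c" "c > 0" "k < j"
    using le(2) k_le_b by linarith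
  then show ?thesis
    by cases (use le meet in \<open>auto simp: xy below.simps max_def split: if_splits\<close>)
qed

lemma row_path_of:
  assumes x: "x \<in> coords a b"
  shows "row T (path_of a b x) = path_of a b (row_coord a b k x)"
proof (rule row_eqI)
  have pop: "path_of a b x \<sqinter>\<^bsub>T\<^esub> path_of a b y = pop_down T (path_of a b x) \<longleftrightarrow>
      meet_coord k x y = pop_coord b k x" if "y \<in> coords a b" for y
    unfolding meet_path_of[OF x that] pop_down_path_of[OF x]
    using inj_on_eq_iff[OF inj_on_path_of meet_coord_in[OF x that] pop_coord_in[OF x]] .
  show "path_of a b (row_coord a b k x) \<in> carrier T"
    using row_coord_in[OF x] by (simp add: carrier_T)
  show "path_of a b x \<sqinter>\<^bsub>T\<^esub> path_of a b (row_coord a b k x) = pop_down T (path_of a b x)"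
    using pop[OF row_coord_in[OF x]] meet_row_coord[OF x] by simp
  fix z assume z: "z \<in> carrier T" "path_of a b x \<sqinter>\<^bsub>T\<^esub> z = pop_down T (path_of a b x)"
  then obtain y where y: "y \<in> coords a b" "z = path_of a b y" by (auto simp: carrier_T)
  then have "below k y (row_coord a b k x)" using z pop row_coord_greatest[OF x y(1)] by simp
  then show "z \<sqsubseteq>\<^bsub>T\<^esub> path_of a b (row_coord a b k x)"
    using le_path_of_iff[OF y(1) row_coord_in[OF x]] y(2) by simp
qed

lemma inj_on_row_coord: "inj_on (row_coord a b k) (coords a b)"
proof (rule inj_on_inverseI)
  \<comment> \<open>Column \<open>a\<close> receives column 0 cut open at \<open>k\<close>, with the
    bottom sent to \<open>j = 0\<close>; the gap \<open>k + 1, ..., k + a\<close> is filled by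
    \<open>(c, k)\<close> for \<open>c = a, ..., 1\<close>. A column \<open>c < a\<close> receives
    column \<open>c + 1\<close> without its element at \<open>k\<close>.\<close>
  let ?inv = "\<lambda>(c, j).
    if c = a then
      if j = 0 then (0, b)
      else if j \<le> k then (0, j - 1)
      else if j \<le> k + a then (k + 1 + a - j, k)
      else (0, j - 1 - a)
    else if j = 0 then (c + 1, b + c + 1)
    else (c + 1, if j \<le> k then j - 1 else j)"
  fix x assume "x \<in> coords a b"
  then obtain c j where x: "x = (c, j)" and le: "c \<le> a" "j \<le> b + c"
    by (cases x) (auto simp: coords_def)
  consider "j = b + c" "c = 0" | "j = b + c" "c > 0" "k < j" | "j < b + c" "j = k" "c > 0"
    | "j < b + c" "c = 0" "k \<le> j" | "j < b + c" "c = 0" "j < k"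
    | "j < b + c" "c > 0" "j < k" | "j < b + c" "c > 0" "k < j"
    using le(2) k_le_b by linarith
  then show "?inv (row_coord a b k x) = x"
    by cases (use le k_le_b in \<open>auto simp: x\<close>)
qed

lemma row_coord_invariant: "row_coord a b k ` coords a b \<subseteq> coords a b"
  using row_coord_in by blast

lemma orbit_ddeg_structure_eq_coord:
  "orbit_ddeg_structure T = weighted_orbits (row_coord a b k) (ddeg_coord b k) (coords a b)"
proof -
  have "orbit_ddeg_structure T = weighted_orbits (row T) (ddeg T) (path_of a b ` coords a b)"
    unfolding orbit_ddeg_structure_def row_orbits_def weighted_orbits_def carrier_T ..
  also have "\<dots> = weighted_orbits (row_coord a b k) (ddeg_coord b k) (coords a b)"
    by (rule weighted_orbits_semiconj[where h = "\<lambda>_. 0"])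
      (simp_all add: finite_coords row_coord_invariant inj_on_row_coord inj_on_path_of row_path_of
        ddeg_path_of)
  finally show ?thesis .
qed

end

section \<open>Independence of the increment vector\<close>

fun rotate_column :: "nat \<Rightarrow> nat \<times> nat \<Rightarrow> nat \<times> nat" where
  "rotate_column b (c, j) = (c, if j = b + c then 0 else j + 1)"

lemma bij_betw_rotate_column: "bij_betw (rotate_column b) (coords a b) (coords a b)"
  by (rule bij_betw_byWitness[where f' = "\<lambda>(c, j). (c, if j = 0 then b + c else j - 1)"])
    (auto simp: coords_def)

text \<open>Replace \<open>j\<close> by its cyclic offset \<open>t\<close> from \<open>k\<close>,
  modulo the column size \<open>b + c + 1\<close>. Rowmotion sends \<open>(c, t)\<close> with
  \<open>c, t > 0\<close> to offset \<open>t\<close> in column \<open>c - 1\<close>,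
  \<open>(c, 0)\<close> with \<open>c > 0\<close> to offset \<open>a - c + 1\<close> in column
  \<open>a\<close>, and \<open>(0, t)\<close> to offset \<open>a + t + 1\<close> in column
  \<open>a\<close>, modulo the size of the target column. This description is free of
  \<open>k\<close>, and rotating all columns while raising \<open>k\<close> keeps every
  offset.\<close>

lemma row_coord_rotate_column:
  assumes "Suc k \<le> b" "x \<in> coords a b"
  shows "row_coord a b (Suc k) (rotate_column b x) = rotate_column b (row_coord a b k x)"
proof -
  obtain c j where x: "x = (c, j)" and le: "c \<le> a" "j \<le> b + c"
    using assms(2) by (cases x) (auto simp: coords_def)
  consider "j = b + c" "c = 0" | "j = b + c" "c > 0" | "j < b + c" "j = k" "c > 0"
    | "j < b + c" "c = 0" "k \<le> j" | "j < b + c" "c = 0" "j < k"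
    | "j < b + c" "c > 0" "j < k" | "j < b + c" "c > 0" "k < j"
    using le(2) by linarith
  then show ?thesis
    by cases (use le assms(1) in \<open>auto simp: x\<close>)
qed

text \<open>
  Rotating the columns changes the down-degree by a coboundary, as the lowest element
  \<open>(c, b + c)\<close> of a column is the image under rowmotion of the element just above the lowest one in
  the next column (cyclically).
\<close>

lemma ddeg_coord_rotate_column:
  assumes "Suc k \<le> b" "x \<in> coords a b"
  defines "h \<equiv> \<lambda>(c, j). if j = b + c then 1 else 0"
  shows "ddeg_coord b (Suc k) (rotate_column b x) + h (row_coord a b k x) = ddeg_coord b k x + h x"
proof -
  obtain c j where x: "x = (c, j)" and le: "c \<le> a" "j \<le> b + c"
    using assms(2) by (cases x) (auto simp: coords_def)
  consider "j = b + c" "c = 0" | "j = b + c" "c > 0" | "j < b + c" "j = k" "c > 0"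
    | "j < b + c" "c = 0" "k \<le> j" | "j < b + c" "c = 0" "j < k"
    | "j < b + c" "c > 0" "j < k" | "j < b + c" "c > 0" "k < j"
    using le(2) by linarith
  then show ?thesis
    by cases (use le assms(1) in \<open>auto simp: x h_def\<close>)
qed

lemma weighted_orbits_coord_Suc:
  assumes "Suc k \<le> b"
  shows "weighted_orbits (row_coord a b (Suc k)) (ddeg_coord b (Suc k)) (coords a b) =
    weighted_orbits (row_coord a b k) (ddeg_coord b k) (coords a b)"
proof -
  interpret two_row a b k by unfold_locales (use assms in simp)
  have col: "rotate_column b ` coords a b = coords a b" "inj_on (rotate_column b) (coords a b)"
    using bij_betw_rotate_column by (auto simp: bij_betw_def)
  have "weighted_orbits (row_coord a b (Suc k)) (ddeg_coord b (Suc k)) (rotate_column b ` coords a b) =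
    weighted_orbits (row_coord a b k) (ddeg_coord b k) (coords a b)"
  proof (rule weighted_orbits_semiconj[where h = "\<lambda>(c, j). if j = b + c then 1 else 0"])
    fix x assume x: "x \<in> coords a b"
    show "row_coord a b (Suc k) (rotate_column b x) = rotate_column b (row_coord a b k x)"
      by (rule row_coord_rotate_column[OF assms x])
    show "ddeg_coord b (Suc k) (rotate_column b x) +
        (case row_coord a b k x of (c, j) \<Rightarrow> if j = b + c then 1 else 0) =
      ddeg_coord b k x + (case x of (c, j) \<Rightarrow> if j = b + c then 1 else 0)"
      by (rule ddeg_coord_rotate_column[OF assms x])
  qed (rule finite_coords row_coord_invariant inj_on_row_coord col(2))+
  then show ?thesis unfolding col(1) .
qed

text \<open>The case \<open>k = 0\<close> serves as the common value with which every increment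
  vector is compared, one unit at a time.\<close>

lemma orbit_ddeg_structure_two_row:
  assumes "k \<le> b"
  shows "orbit_ddeg_structure (alt_two_row_tamari a b k) =
    weighted_orbits (row_coord a b 0) (ddeg_coord b 0) (coords a b)"
proof -
  interpret two_row a b k by unfold_locales (rule assms)
  have "weighted_orbits (row_coord a b k) (ddeg_coord b k) (coords a b) =
      weighted_orbits (row_coord a b 0) (ddeg_coord b 0) (coords a b)"
    using assms by (induction k) (simp_all only: weighted_orbits_coord_Suc Suc_leD)
  then show ?thesis by (simp add: orbit_ddeg_structure_eq_coord)
qed

lemma orbit_structure_eq_fst: "orbit_structure L = image_mset fst (orbit_ddeg_structure L)"
  by (simp add: orbit_structure_def orbit_ddeg_structure_def multiset.map_comp o_def)

theorem theorem4p9: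
  fixes a b k k' :: nat
  assumes "k \<le> b" and "k' \<le> b"
  shows "orbit_structure (alt_two_row_tamari a b k) = orbit_structure (alt_two_row_tamari a b k') \<and>
         orbit_ddeg_structure (alt_two_row_tamari a b k) =
         orbit_ddeg_structure (alt_two_row_tamari a b k')"
  using assms by (simp add: orbit_structure_eq_fst orbit_ddeg_structure_two_row)

end
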